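(* Let $I=[a,b]\subset\mathbb{R}$ be a closed bounded interval ($a<b$), let $p>1$ and let $\varphi\in\Phi_{\mathrm c}$ (independent of $x$). Then $\mathrm V^\varphi_I$ and $\mathrm V^p_I$ generate the same space, i.e. $\mathrm{RBV}^\varphi(I)=\mathrm{RBV}^p(I)$, if and only if there exists a constant $c\ge1$ such that $$\tfrac1c\,t^p-c\le\varphi(t)\le c\,t^p+c\qquad\text{for all }t\ge0.$$
   Context: $\Phi_{\mathrm c}$ is the set of functions $\varphi:[0,\infty)\to[0,\infty]$ that are non-decreasing, convex and left-continuous with $\varphi(0)=\lim_{t\to0^+}\varphi(t)=0$ and $\lim_{t\to\infty}\varphi(t)=\infty$. A partition $(I_k)_{k=1}^n$ of $I$ is a finite family of non-degenerate closed intervals with disjoint interiors and union $I$. For $I_k=[a_k,b_k]$, $\Delta_kf:=f(a_k)-f(b_k)$. For $f:I\to\mathbb{R}$, $$\mathrm V^\varphi_I(f):=\sup_{(I_k)}\sum_{k=1}^n\varphi\Big(\frac{|\Delta_kf|}{|I_k|}\Big)|I_k|,$$ the supremum being over all partitions of $I$, and $\mathrm{RBV}^\varphi(I):=\{f:I\to\mathbb{R}\mid\lim_{\lambda\to0}\mathrm V^\varphi_I(\lambda f)=0\}$. $\mathrm V^p_I$ and $\mathrm{RBV}^p(I)$ denote these objects for $\varphi(t)=t^p$. *)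

theory Defs
  imports "HOL-Analysis.Analysis"
begin

text \<open>
  Functions \<open>\<phi> : [0,\<infinity>) \<rightarrow> [0,\<infinity>]\<close> are rendered as \<^typ>\<open>real \<Rightarrow> ennreal\<close>; values at negative
  arguments play no role. The library's \<^const>\<open>convex_on\<close> is restricted to real-valued functions,
  so convexity is spelled out here, with weights in the open unit interval so that no product
  \<open>0 \<cdot> \<infinity>\<close> occurs.
\<close>

definition Phi_c :: "(real \<Rightarrow> ennreal) set" where
  "Phi_c = {\<phi>.
     mono_on {0..} \<phi> \<and>
     (\<forall>s\<ge>0. \<forall>t\<ge>0. \<forall>\<theta>. 0 < \<theta> \<longrightarrow> \<theta> < 1 \<longrightarrow>
        \<phi> ((1 - \<theta>) * s + \<theta> * t) \<le> ennreal (1 - \<theta>) * \<phi> s + ennreal \<theta> * \<phi> t) \<and>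
     (\<forall>t>0. continuous (at_left t) \<phi>) \<and>
     \<phi> 0 = 0 \<and> (\<phi> \<longlongrightarrow> 0) (at_right 0) \<and> (\<phi> \<longlongrightarrow> \<infinity>) at_top}"

text \<open>
  \<open>division_of\<close> admits degenerate intervals, which are excluded here. Non-degenerate intervals with
  disjoint interiors are distinct, so a set of intervals carries the same data as a finite family.
\<close>

definition partitions :: "real set \<Rightarrow> real set set set" where
  "partitions I = {D. D division_of I \<and> (\<forall>K\<in>D. interior K \<noteq> {})}"

definition riesz_variation :: "(real \<Rightarrow> ennreal) \<Rightarrow> real set \<Rightarrow> (real \<Rightarrow> real) \<Rightarrow> ennreal" where
  "riesz_variation \<phi> I f =
     (SUP D\<in>partitions I. \<Sum>K\<in>D. \<phi> (\<bar>f (Inf K) - f (Sup K)\<bar> / measure lborel K) * ennreal (measure lborel K))"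

definition RBV :: "(real \<Rightarrow> ennreal) \<Rightarrow> real set \<Rightarrow> (real \<Rightarrow> real) set" where
  "RBV \<phi> I = {f \<in> I \<rightarrow>\<^sub>E UNIV.
     ((\<lambda>l. riesz_variation \<phi> I (\<lambda>x. l * f x)) \<longlongrightarrow> 0) (at 0)}"

definition power_phi :: "real \<Rightarrow> real \<Rightarrow> ennreal" where
  "power_phi p t = ennreal (t powr p)"

end

theory Submission
  imports Defs
begin

text \<open>
  For \<open>\<phi>, \<psi> \<in> \<Phi>\<^sub>c\<close>, the inclusion of \<open>RBV \<phi>\<close> in \<open>RBV \<psi>\<close> holds iff \<open>\<psi> t \<le> c (\<phi> (k t) + 1)\<close> for
  some \<open>c, k > 0\<close>; when one of the two functions is a power, the factor \<open>k\<close> can be absorbed into \<open>c\<close>.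
  If the domination fails, there are \<open>t\<^sub>n\<close> with \<open>\<psi> t\<^sub>n > A 2\<^sup>n\<^sup>+\<^sup>1 (\<phi> s\<^sub>n + 1)\<close>, where \<open>s\<^sub>n = (n + 1) t\<^sub>n\<close>. Let \<open>f\<close>
  have slope \<open>s\<^sub>n\<close> on consecutive intervals of length \<open>m\<^sub>n = 1 / (A 2\<^sup>n\<^sup>+\<^sup>1 (\<phi> s\<^sub>n + 1))\<close>. By Jensen's
  inequality the \<open>\<phi>\<close>-variation of \<open>f\<close> is at most \<open>\<Sum> m\<^sub>n \<phi> s\<^sub>n < \<infinity>\<close>, while for every \<open>l > 0\<close> all terms
  with \<open>l (n + 1) \<ge> 1\<close> contribute at least \<open>m\<^sub>n \<psi> t\<^sub>n \<ge> 1\<close> to the \<open>\<psi>\<close>-variation of \<open>l f\<close>.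
\<close>

section \<open>Functions in \<open>\<Phi>\<^sub>c\<close>\<close>

lemma Phi_c_mono: "\<phi> \<in> Phi_c \<Longrightarrow> 0 \<le> s \<Longrightarrow> s \<le> t \<Longrightarrow> \<phi> s \<le> \<phi> t"
  by (auto simp: Phi_c_def mono_on_def)

lemma Phi_c_convex:
  assumes "\<phi> \<in> Phi_c" "0 \<le> s" "0 \<le> t" "0 < \<theta>" "\<theta> < 1"
  shows "\<phi> ((1 - \<theta>) * s + \<theta> * t) \<le> ennreal (1 - \<theta>) * \<phi> s + ennreal \<theta> * \<phi> t"
  using assms by (auto simp: Phi_c_def)

lemma Phi_c_zero: "\<phi> \<in> Phi_c \<Longrightarrow> \<phi> 0 = 0"
  by (auto simp: Phi_c_def)

text \<open>Convexity on the segment from 0 to \<open>t\<close>, where \<open>\<phi> 0 = 0\<close>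
  removes one term. The weights 0 and 1 are split off because convexity is stated for weights
  strictly between them.\<close>

lemma Phi_c_subhomogeneous:
  assumes "\<phi> \<in> Phi_c" "0 \<le> \<theta>" "\<theta> \<le> 1" "0 \<le> t"
  shows "\<phi> (\<theta> * t) \<le> ennreal \<theta> * \<phi> t"
proof -
  consider "\<theta> = 0" | "\<theta> = 1" | "0 < \<theta>" "\<theta> < 1"
    using assms by linarith
  then show ?thesis
    using Phi_c_convex[OF assms(1) order_refl assms(4), of \<theta>] Phi_c_zero[OF assms(1)]
    by cases auto
qed

text \<open>The weights may sum to less than 1: the missing mass sits at the point 0, where
  \<open>\<phi>\<close> vanishes.\<close>

lemma Phi_c_jensen:
  assumes "\<phi> \<in> Phi_c" and "finite S"
    and "\<And>i. i \<in> S \<Longrightarrow> 0 \<le> \<theta> i" and "\<And>i. i \<in> S \<Longrightarrow> 0 \<le> s i" and "sum \<theta> S \<le> 1"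
  shows "\<phi> (\<Sum>i\<in>S. \<theta> i * s i) \<le> (\<Sum>i\<in>S. ennreal (\<theta> i) * \<phi> (s i))"
  using assms(2-5)
proof (induction S arbitrary: \<theta> rule: finite_induct)
  case empty
  show ?case using Phi_c_zero[OF assms(1)] by simp
next
  case (insert j S)
  have nn: "0 \<le> sum \<theta> S" "0 \<le> \<theta> j"
    using insert.prems by (auto intro: sum_nonneg)
  have le: "sum \<theta> S \<le> 1 - \<theta> j"
    using insert by simp
  consider "\<theta> j = 0" | "\<theta> j = 1" | "0 < \<theta> j" "\<theta> j < 1"
    using nn le by linarith
  then show ?case
  proof cases
    case 1
    then show ?thesis using insert by simp
  next
    case 2
    then have "sum \<theta> S = 0"
      using le nn by linarith
    then have "\<theta> i = 0" if "i \<in> S" for i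
      using that insert by (simp add: sum_nonneg_eq_0_iff)
    then show ?thesis
      using 2 insert.hyps by simp
  next
    case 3
    \<comment> \<open>Renormalising the weights other than \<open>\<theta> j\<close> keeps their sum
      at most 1, and turns the whole sum into a convex combination of \<open>s j\<close> with a sum
      over \<open>S\<close>.\<close>
    let ?\<eta> = "\<lambda>i. \<theta> i / (1 - \<theta> j)"
    have IH: "\<phi> (\<Sum>i\<in>S. ?\<eta> i * s i) \<le> (\<Sum>i\<in>S. ennreal (?\<eta> i) * \<phi> (s i))"
    proof (rule insert.IH)
      show "sum ?\<eta> S \<le> 1"
        using le 3 by (simp add: sum_divide_distrib[symmetric])
    qed (use insert.prems 3 in auto)
    have "(\<Sum>i\<in>insert j S. \<theta> i * s i) = (1 - \<theta> j) * (\<Sum>i\<in>S. ?\<eta> i * s i) + \<theta> j * s j"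
      using insert.hyps 3 by (simp add: sum_distrib_left)
    also have "\<phi> \<dots> \<le> ennreal (1 - \<theta> j) * \<phi> (\<Sum>i\<in>S. ?\<eta> i * s i) + ennreal (\<theta> j) * \<phi> (s j)"
      using 3 insert.prems by (intro Phi_c_convex[OF assms(1)] sum_nonneg) auto
    also have "\<dots> \<le> ennreal (1 - \<theta> j) * (\<Sum>i\<in>S. ennreal (?\<eta> i) * \<phi> (s i)) + ennreal (\<theta> j) * \<phi> (s j)"
      by (intro add_mono mult_left_mono IH) auto
    also have "ennreal (1 - \<theta> j) * (\<Sum>i\<in>S. ennreal (?\<eta> i) * \<phi> (s i)) = (\<Sum>i\<in>S. ennreal (\<theta> i) * \<phi> (s i))"
      unfolding sum_distrib_left
    proof (rule sum.cong[OF refl])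
      fix i assume "i \<in> S"
      then have "ennreal (\<theta> i) = ennreal (1 - \<theta> j) * ennreal (?\<eta> i)"
        using 3 insert.prems by (subst ennreal_mult[symmetric]) auto
      then show "ennreal (1 - \<theta> j) * (ennreal (?\<eta> i) * \<phi> (s i)) = ennreal (\<theta> i) * \<phi> (s i)"
        by (simp add: mult.assoc)
    qed
    finally show ?thesis
      using insert.hyps by (simp add: add.commute)
  qed
qed

text \<open>The partial sums increase to the limit \<open>x\<close>, so every \<open>y < x\<close>
  is exceeded by one of them and \<open>\<phi> y \<le> B\<close> follows from finite Jensen.
  Left-continuity carries the bound to \<open>x\<close> itself, even where \<open>\<phi>\<close>
  jumps to infinity to the right of \<open>x\<close>.\<close>

lemma Phi_c_jensen_suminf:
  assumes "\<phi> \<in> Phi_c" and \<theta>: "\<And>i. 0 \<le> \<theta> i" and s: "\<And>i. 0 \<le> s i"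
    and le1: "\<And>N. sum \<theta> {..<N} \<le> 1" and sm: "summable (\<lambda>i. \<theta> i * s i)"
  shows "\<phi> (\<Sum>i. \<theta> i * s i) \<le> (\<Sum>i. ennreal (\<theta> i) * \<phi> (s i))"
proof -
  define x where "x = (\<Sum>i. \<theta> i * s i)"
  define B where "B = (\<Sum>i. ennreal (\<theta> i) * \<phi> (s i))"
  have part: "\<phi> (\<Sum>i<N. \<theta> i * s i) \<le> B" for N
  proof -
    have "\<phi> (\<Sum>i<N. \<theta> i * s i) \<le> (\<Sum>i<N. ennreal (\<theta> i) * \<phi> (s i))"
      using assms by (intro Phi_c_jensen) auto
    also have "\<dots> \<le> B"
      unfolding B_def by (intro sum_le_suminf) auto
    finally show ?thesis .
  qed
  have "0 \<le> x"
    unfolding x_def using \<theta> s by (intro suminf_nonneg sm) auto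
  then consider "x = 0" | "0 < x" by linarith
  then have "\<phi> x \<le> B"
  proof cases
    case 2
    have lim: "(\<phi> \<longlongrightarrow> \<phi> x) (at_left x)"
      using assms(1) 2 by (auto simp: Phi_c_def continuous_within)
    have "\<phi> y \<le> B" if "y \<in> {0<..<x}" for y
    proof -
      have "(\<lambda>N. \<Sum>i<N. \<theta> i * s i) \<longlonglongrightarrow> x"
        using summable_LIMSEQ[OF sm] by (simp add: x_def)
      then have "\<forall>\<^sub>F N in sequentially. y < (\<Sum>i<N. \<theta> i * s i)"
        using that by (intro order_tendstoD) auto
      then obtain N where "y < (\<Sum>i<N. \<theta> i * s i)"
        by (auto simp: eventually_sequentially)
      then show ?thesis
        using Phi_c_mono[OF assms(1), of y "\<Sum>i<N. \<theta> i * s i"] part[of N] that by auto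
    qed
    then have "\<forall>\<^sub>F y in at_left x. \<phi> y \<le> B"
      using eventually_at_left_field 2 by (metis greaterThanLessThan_iff)
    then show ?thesis
      by (rule tendsto_upperbound[OF lim]) simp
  qed (simp add: Phi_c_zero[OF assms(1)])
  then show ?thesis by (simp add: x_def B_def)
qed

text \<open>Once \<open>\<phi> T > 1\<close>, subhomogeneity forces
  \<open>\<phi> s \<ge> s / T\<close> for all \<open>s > T\<close>. This later makes the series
  defining the broken line converge.\<close>

lemma Phi_c_superlinear:
  assumes "\<phi> \<in> Phi_c"
  obtains T where "0 < T" "\<And>s. 0 \<le> s \<Longrightarrow> ennreal s \<le> ennreal T * (\<phi> s + 1)"
proof -
  have "(\<phi> \<longlongrightarrow> top) at_top"
    using assms by (auto simp: Phi_c_def)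
  then have "\<forall>\<^sub>F t in at_top. 1 < \<phi> t"
    by (rule order_tendstoD) simp
  then have "\<forall>\<^sub>F t in at_top. 1 < \<phi> t \<and> 0 < t"
    using eventually_gt_at_top by (rule eventually_conj)
  then obtain T where T: "1 < \<phi> T" "0 < T"
    using eventually_happens'[OF trivial_limit_at_top_linorder] by blast
  show ?thesis
  proof (rule that[OF T(2)])
    fix s :: real assume s: "0 \<le> s"
    show "ennreal s \<le> ennreal T * (\<phi> s + 1)"
    proof (cases "s \<le> T")
      case True
      then have "ennreal s \<le> ennreal T * 1" by (simp add: ennreal_leI)
      also have "\<dots> \<le> ennreal T * (\<phi> s + 1)" by (intro mult_left_mono) auto
      finally show ?thesis .
    next
      case False
      have "1 \<le> \<phi> (T / s * s)"
        using T False by auto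
      also have "\<dots> \<le> ennreal (T / s) * \<phi> s"
        using T False by (intro Phi_c_subhomogeneous[OF assms]) auto
      finally have "ennreal s * 1 \<le> ennreal s * (ennreal (T / s) * \<phi> s)"
        by (rule mult_left_mono) simp
      also have "\<dots> = ennreal T * \<phi> s"
        using T False by (simp add: mult.assoc[symmetric] ennreal_mult[symmetric])
      also have "\<dots> \<le> ennreal T * (\<phi> s + 1)"
        by (intro mult_left_mono) auto
      finally show ?thesis by simp
    qed
  qed
qed

text \<open>For positive \<open>s\<close> and \<open>t\<close> this is convexity of the power. If
  one of them is 0, it reduces to \<open>\<eta> powr p \<le> \<eta>\<close> for
  \<open>0 < \<eta> < 1\<close>.\<close>

lemma powr_convex_combination_le:
  fixes p :: real
  assumes "1 \<le> p" "0 \<le> s" "0 \<le> t" "0 < \<theta>" "\<theta> < 1"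
  shows "((1 - \<theta>) * s + \<theta> * t) powr p \<le> (1 - \<theta>) * s powr p + \<theta> * t powr p"
proof -
  have le: "(\<eta> * x) powr p \<le> \<eta> * x powr p" if "0 < \<eta>" "\<eta> < 1" "0 \<le> x" for \<eta> x
  proof -
    have "\<eta> powr p \<le> \<eta> powr 1"
      using that assms by (intro powr_mono') auto
    then show ?thesis using that by (simp add: powr_mult mult_right_mono)
  qed
  consider "s = 0" | "t = 0" | "0 < s" "0 < t" using assms by linarith
  then show ?thesis
  proof cases
    case 3
    then show ?thesis
      using convex_onD[OF powr_convex[OF assms(1)], of \<theta> s t] assms by simp
  qed (use le[of \<theta> t] le[of "1 - \<theta>" s] assms in auto)
qed

lemma power_phi_in_Phi_c:
  assumes "1 \<le> p"
  shows "power_phi p \<in> Phi_c"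
  unfolding Phi_c_def
proof (intro CollectI conjI allI impI)
  show "mono_on {0..} (power_phi p)"
    using assms by (auto simp: mono_on_def power_phi_def intro!: ennreal_leI powr_mono2)
next
  fix s t \<theta> :: real
  assume "0 \<le> s" "0 \<le> t" "0 < \<theta>" "\<theta> < 1"
  then have "ennreal (((1 - \<theta>) * s + \<theta> * t) powr p) \<le> ennreal ((1 - \<theta>) * s powr p + \<theta> * t powr p)"
    using assms by (intro ennreal_leI powr_convex_combination_le) auto
  then show "power_phi p ((1 - \<theta>) * s + \<theta> * t) \<le> ennreal (1 - \<theta>) * power_phi p s + ennreal \<theta> * power_phi p t"
    using \<open>0 < \<theta>\<close> \<open>\<theta> < 1\<close> by (simp add: power_phi_def ennreal_mult)
next
  fix t :: real assume "0 < t"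
  then show "continuous (at_left t) (power_phi p)"
    unfolding power_phi_def continuous_within by (intro tendsto_intros) auto
next
  show "power_phi p 0 = 0" by (simp add: power_phi_def)
next
  have "((\<lambda>t. t powr p) \<longlongrightarrow> 0 powr p) (at_right 0)"
    using assms by (intro tendsto_powr' tendsto_intros) (auto simp: eventually_at_right_less
        intro: eventually_at_rightI[of 0 1])
  then show "(power_phi p \<longlongrightarrow> 0) (at_right 0)"
    unfolding power_phi_def using tendsto_ennrealI by fastforce
next
  have "filterlim (\<lambda>t. t powr p) at_top at_top"
  proof (rule filterlim_at_top_mono[OF filterlim_ident])
    show "\<forall>\<^sub>F t::real in at_top. t \<le> t powr p"
      using eventually_ge_at_top[of 1]
    proof eventually_elim
      case (elim t)
      then show ?case using powr_mono[OF assms, of t] by simp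
    qed
  qed
  then show "(power_phi p \<longlongrightarrow> \<infinity>) at_top"
    unfolding power_phi_def by (simp add: ennreal_tendsto_top_eq_at_top)
qed

section \<open>Partitions and variation\<close>

lemma partitions_interval:
  assumes "D \<in> partitions {a..b::real}" "K \<in> D"
  obtains x y where "K = {x..y}" "x < y" "a \<le> x" "y \<le> b"
proof -
  have D: "D division_of {a..b}" and "interior K \<noteq> {}"
    using assms by (auto simp: partitions_def)
  obtain x y where K: "K = {x..y}"
    using division_ofD(4)[OF D assms(2)] by auto
  then have "x < y"
    using \<open>interior K \<noteq> {}\<close> by (auto simp: not_less interior_atLeastAtMost_real)
  moreover have "{x..y} \<subseteq> {a..b}"
    using division_ofD(2)[OF D assms(2)] K by simp
  ultimately show ?thesis
    using K by (intro that[of x y]) auto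
qed

text \<open>Telescoping: the increment of \<open>g\<close> is an additive interval function, so its
  sum over a division is its value on the whole interval. With \<open>g\<close> the identity this
  gives the total length.\<close>

lemma partitions_sum_increments:
  fixes g :: "real \<Rightarrow> real"
  assumes "D \<in> partitions {a..b}" "a \<le> b"
  shows "(\<Sum>K\<in>D. g (Sup K) - g (Inf K)) = g b - g a"
proof -
  \<comment> \<open>An additive interval function must vanish on the empty set, where
    \<open>Sup\<close> and \<open>Inf\<close> have no meaningful value.\<close>
  let ?f = "\<lambda>K::real set. if K = {} then 0 else g (Sup K) - g (Inf K)"
  interpret operative_real plus 0 ?f
    rewrites "comm_monoid_set.F (+) 0 = sum"
    by standard[1] (auto simp add: sum_def)
  have "sum ?f D = ?f {a..b}"
    using assms by (intro division) (auto simp: partitions_def)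
  moreover have "sum ?f D = (\<Sum>K\<in>D. g (Sup K) - g (Inf K))"
  proof (intro sum.cong refl)
    fix K assume "K \<in> D"
    then obtain x y where "K = {x..y}" "x < y"
      using assms(1) by (elim partitions_interval)
    then show "?f K = g (Sup K) - g (Inf K)" by simp
  qed
  ultimately show ?thesis using assms by simp
qed

lemma riesz_variation_cong:
  assumes "\<And>x. a \<le> x \<Longrightarrow> x \<le> b \<Longrightarrow> f x = g x"
  shows "riesz_variation \<phi> {a..b} f = riesz_variation \<phi> {a..b} g"
  unfolding riesz_variation_def
proof (intro SUP_cong sum.cong refl)
  fix D K assume "D \<in> partitions {a..b}" "K \<in> D"
  then show "\<phi> (\<bar>f (Inf K) - f (Sup K)\<bar> / measure lborel K) * ennreal (measure lborel K) =
      \<phi> (\<bar>g (Inf K) - g (Sup K)\<bar> / measure lborel K) * ennreal (measure lborel K)"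
    using assms by (elim partitions_interval) auto
qed

text \<open>Subhomogeneity with \<open>\<theta> = \<bar>l\<bar> / l0\<close>, applied to each term
  of the sum over a partition.\<close>

lemma riesz_variation_scale_le:
  assumes "\<phi> \<in> Phi_c" "\<bar>l\<bar> \<le> l0" "0 < l0"
  shows "riesz_variation \<phi> I (\<lambda>x. l * f x) \<le> ennreal (\<bar>l\<bar> / l0) * riesz_variation \<phi> I (\<lambda>x. l0 * f x)"
  unfolding riesz_variation_def
proof (rule SUP_least)
  fix D assume D: "D \<in> partitions I"
  let ?S = "\<lambda>l. \<Sum>K\<in>D. \<phi> (\<bar>l * f (Inf K) - l * f (Sup K)\<bar> / measure lborel K) * ennreal (measure lborel K)"
  have "?S l \<le> ennreal (\<bar>l\<bar> / l0) * ?S l0"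
    unfolding sum_distrib_left
  proof (rule sum_mono)
    fix K
    let ?t = "\<lambda>l. \<bar>l * f (Inf K) - l * f (Sup K)\<bar> / measure lborel K"
    have "?t l = \<bar>l\<bar> / l0 * ?t l0"
      using assms by (simp add: right_diff_distrib[symmetric] abs_mult)
    also have "\<phi> \<dots> \<le> ennreal (\<bar>l\<bar> / l0) * \<phi> (?t l0)"
      using assms by (intro Phi_c_subhomogeneous) auto
    finally show "\<phi> (?t l) * ennreal (measure lborel K)
        \<le> ennreal (\<bar>l\<bar> / l0) * (\<phi> (?t l0) * ennreal (measure lborel K))"
      unfolding mult.assoc[symmetric] by (rule mult_right_mono) simp
  qed
  also have "\<dots> \<le> ennreal (\<bar>l\<bar> / l0) * (SUP D\<in>partitions I. \<Sum>K\<in>D. \<phi> (\<bar>l0 * f (Inf K) - l0 * f (Sup K)\<bar> / measure lborel K) * ennreal (measure lborel K))"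
    by (intro mult_left_mono SUP_upper D) simp
  finally show "?S l \<le> \<dots>" .
qed

text \<open>Finiteness at one scale \<open>l0\<close> suffices, because the variation at a smaller
  scale \<open>l\<close> is at most \<open>\<bar>l\<bar> / l0\<close> times that finite value and so
  tends to 0 with \<open>l\<close>.\<close>

lemma RBV_iff:
  assumes "\<phi> \<in> Phi_c"
  shows "f \<in> RBV \<phi> I \<longleftrightarrow> f \<in> I \<rightarrow>\<^sub>E UNIV \<and> (\<exists>l>0. riesz_variation \<phi> I (\<lambda>x. l * f x) < \<infinity>)"
proof -
  let ?V = "\<lambda>l. riesz_variation \<phi> I (\<lambda>x. l * f x)"
  have "(\<exists>l>0. ?V l < \<infinity>)" if "(?V \<longlongrightarrow> 0) (at 0)"
  proof -
    have "\<forall>\<^sub>F l in at 0. ?V l < 1"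
      using that by (rule order_tendstoD) simp
    then have "\<forall>\<^sub>F l in at_right 0. ?V l < 1"
      by (simp add: eventually_at_split)
    then have "\<forall>\<^sub>F l in at_right 0. ?V l < 1 \<and> 0 < l"
      using eventually_at_right_less by (rule eventually_conj)
    then obtain l where "?V l < 1" "0 < l"
      using eventually_happens'[OF trivial_limit_at_right_real] by blast
    then show ?thesis
      by (metis ennreal_one_less_top infinity_ennreal_def order.strict_trans)
  qed
  moreover have "(?V \<longlongrightarrow> 0) (at 0)" if l0: "0 < l0" "?V l0 < \<infinity>" for l0
  proof -
    obtain r where r: "?V l0 = ennreal r" "0 \<le> r"
      using l0 by (cases "?V l0") auto
    have "\<forall>\<^sub>F l in at 0. \<bar>l\<bar> \<le> l0"
      using l0 by (auto simp: eventually_at dist_real_def intro!: exI[of _ l0])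
    then have le: "\<forall>\<^sub>F l in at 0. ?V l \<le> ennreal (\<bar>l\<bar> / l0 * r)"
    proof eventually_elim
      case (elim l)
      have "?V l \<le> ennreal (\<bar>l\<bar> / l0) * ennreal r"
        using riesz_variation_scale_le[OF assms elim l0(1), of I f] r(1) by simp
      also have "\<dots> = ennreal (\<bar>l\<bar> / l0 * r)"
        using r l0 by (intro ennreal_mult[symmetric]) auto
      finally show ?case .
    qed
    have "((\<lambda>l. ennreal (\<bar>l\<bar> / l0 * r)) \<longlongrightarrow> ennreal (\<bar>0\<bar> / l0 * r)) (at 0)"
      using l0 by (intro tendsto_intros) auto
    then have "((\<lambda>l. ennreal (\<bar>l\<bar> / l0 * r)) \<longlongrightarrow> 0) (at 0)"
      by simp
    with _ le tendsto_const show ?thesis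
      by (rule tendsto_sandwich) simp
  qed
  ultimately show ?thesis by (auto simp: RBV_def)
qed

text \<open>The estimate is applied termwise; the summand 1, weighted by the interval lengths, adds
  up to \<open>b - a\<close>.\<close>

lemma riesz_variation_dominated:
  assumes "a \<le> b" "\<And>t. 0 \<le> t \<Longrightarrow> \<psi> t \<le> ennreal c * (\<phi> (k * t) + 1)" "0 \<le> k"
  shows "riesz_variation \<psi> {a..b} f \<le> ennreal c * (riesz_variation \<phi> {a..b} (\<lambda>x. k * f x) + ennreal (b - a))"
  unfolding riesz_variation_def[of \<psi>]
proof (rule SUP_least)
  fix D assume D: "D \<in> partitions {a..b}"
  let ?m = "\<lambda>K. ennreal (measure lborel K)"
  let ?t = "\<lambda>K. \<bar>f (Inf K) - f (Sup K)\<bar> / measure lborel K"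
  let ?u = "\<lambda>K. \<bar>k * f (Inf K) - k * f (Sup K)\<bar> / measure lborel K"
  have "(\<Sum>K\<in>D. measure lborel K) = (\<Sum>K\<in>D. Sup K - Inf K)"
    using D by (intro sum.cong refl) (auto elim: partitions_interval)
  then have len: "(\<Sum>K\<in>D. measure lborel K) = b - a"
    using partitions_sum_increments[OF D assms(1), of "\<lambda>x. x"] by simp
  have "(\<Sum>K\<in>D. \<psi> (?t K) * ?m K) \<le> (\<Sum>K\<in>D. ennreal c * (\<phi> (?u K) * ?m K + ?m K))"
  proof (rule sum_mono)
    fix K
    have "k * ?t K = ?u K"
      using assms(3) by (simp add: right_diff_distrib[symmetric] abs_mult)
    moreover have "\<psi> (?t K) \<le> ennreal c * (\<phi> (k * ?t K) + 1)"
      by (intro assms(2)) simp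
    ultimately have "\<psi> (?t K) \<le> ennreal c * (\<phi> (?u K) + 1)"
      by (simp only:)
    then have "\<psi> (?t K) * ?m K \<le> ennreal c * (\<phi> (?u K) + 1) * ?m K"
      by (rule mult_right_mono) simp
    then show "\<psi> (?t K) * ?m K \<le> ennreal c * (\<phi> (?u K) * ?m K + ?m K)"
      by (simp add: algebra_simps)
  qed
  also have "\<dots> = ennreal c * ((\<Sum>K\<in>D. \<phi> (?u K) * ?m K) + ennreal (b - a))"
    by (simp add: sum_distrib_left[symmetric] sum.distrib len)
  also have "\<dots> \<le> ennreal c * (riesz_variation \<phi> {a..b} (\<lambda>x. k * f x) + ennreal (b - a))"
    unfolding riesz_variation_def by (intro mult_left_mono add_right_mono SUP_upper D) simp
  finally show "(\<Sum>K\<in>D. \<psi> (?t K) * ?m K) \<le> \<dots>" .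
qed

text \<open>If the \<open>\<phi>\<close>-variation is finite at scale \<open>l\<close>, the scale
  \<open>l / k\<close> works for \<open>\<psi>\<close>, since the factor \<open>k\<close>
  cancels.\<close>

lemma RBV_mono_dominated:
  assumes "\<phi> \<in> Phi_c" "\<psi> \<in> Phi_c" "a \<le> b"
    and dom: "\<And>t. 0 \<le> t \<Longrightarrow> \<psi> t \<le> ennreal c * (\<phi> (k * t) + 1)" and "0 < k"
  shows "RBV \<phi> {a..b} \<subseteq> RBV \<psi> {a..b}"
proof
  fix f assume "f \<in> RBV \<phi> {a..b}"
  then obtain l where f: "f \<in> {a..b} \<rightarrow>\<^sub>E UNIV"
    and l: "0 < l" "riesz_variation \<phi> {a..b} (\<lambda>x. l * f x) < \<infinity>"
    using RBV_iff[OF assms(1)] by auto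
  have "riesz_variation \<psi> {a..b} (\<lambda>x. l / k * f x)
      \<le> ennreal c * (riesz_variation \<phi> {a..b} (\<lambda>x. k * (l / k * f x)) + ennreal (b - a))"
    using assms by (intro riesz_variation_dominated) auto
  also have "\<dots> < \<infinity>"
    using l \<open>0 < k\<close> by (simp add: ennreal_mult_less_top)
  finally have "riesz_variation \<psi> {a..b} (\<lambda>x. l / k * f x) < \<infinity>" .
  then show "f \<in> RBV \<psi> {a..b}"
    using f l(1) \<open>0 < k\<close> RBV_iff[OF assms(2)] by (auto intro!: exI[of _ "l / k"])
qed

text \<open>The division is built by appending one interval at a time. Partitions are sets, so
  injectivity is what allows a sum over the partition to be indexed by \<open>i\<close>.\<close>

lemma partitions_of_increasing_sequence:
  fixes v :: "nat \<Rightarrow> real"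
  assumes "\<And>i. i \<le> N \<Longrightarrow> v i < v (Suc i)"
  shows "(\<lambda>i. {v i..v (Suc i)}) ` {..N} \<in> partitions {v 0..v (Suc N)}"
    and "inj_on (\<lambda>i. {v i..v (Suc i)}) {..N}"
proof -
  have mono: "v i \<le> v j" if "i \<le> j" "j \<le> Suc N" for i j
  proof (rule lift_Suc_mono_le_ivl[of "{..N}" v])
    show "v n \<le> v (Suc n)" if "n \<in> {..N}" for n
      using assms[of n] that by simp
  qed (use that in auto)
  have "(\<lambda>i. {v i..v (Suc i)}) ` {..n} division_of {v 0..v (Suc n)}" if "n \<le> N" for n
    using that
  proof (induction n)
    case 0
    have "{{v 0..v 1}} division_of {v 0..v 1}"
      using division_of_self[of "v 0" "v 1"] assms[of 0] by simp
    then show ?case by simp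
  next
    case (Suc n)
    have "v (Suc n) < v (Suc (Suc n))" "v 0 \<le> v (Suc n)"
      using assms Suc.prems mono by auto
    then have "{{v (Suc n)..v (Suc (Suc n))}} division_of {v (Suc n)..v (Suc (Suc n))}"
      using division_of_self[of "v (Suc n)" "v (Suc (Suc n))"] by simp
    then have "(\<lambda>i. {v i..v (Suc i)}) ` {..n} \<union> {{v (Suc n)..v (Suc (Suc n))}}
        division_of {v 0..v (Suc n)} \<union> {v (Suc n)..v (Suc (Suc n))}"
      using Suc by (intro division_disjoint_union) (auto simp: interior_atLeastAtMost_real)
    moreover have "{v 0..v (Suc n)} \<union> {v (Suc n)..v (Suc (Suc n))} = {v 0..v (Suc (Suc n))}"
      using \<open>v (Suc n) < v (Suc (Suc n))\<close> \<open>v 0 \<le> v (Suc n)\<close> by auto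
    ultimately show ?case
      by (simp add: atMost_Suc insert_commute)
  qed
  then show "(\<lambda>i. {v i..v (Suc i)}) ` {..N} \<in> partitions {v 0..v (Suc N)}"
    using assms by (auto simp: partitions_def interior_atLeastAtMost_real dest!: leD)
  have "v i < v j" if "i < j" "j \<le> N" for i j
    using assms[of i] mono[of "Suc i" j] that by simp
  then have "v i \<noteq> v j" if "i \<noteq> j" "i \<le> N" "j \<le> N" for i j
    using that by (metis less_irrefl linorder_neqE_nat)
  then show "inj_on (\<lambda>i. {v i..v (Suc i)}) {..N}"
    using assms by (auto simp: inj_on_def Icc_eq_Icc less_imp_le not_le)
qed

section \<open>Piecewise linear functions with prescribed slopes\<close>

text \<open>\<open>ramp u m x\<close> is the length of \<open>[u, u + m] \<inter> (-\<infinity>, x]\<close>; hence \<open>broken_line a m s\<close> has slope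
  \<open>s n\<close> on the \<open>n\<close>-th of the consecutive intervals of lengths \<open>m 0, m 1, \<dots>\<close> starting at \<open>a\<close>.\<close>

definition ramp :: "real \<Rightarrow> real \<Rightarrow> real \<Rightarrow> real" where
  "ramp u m x = max 0 (min m (x - u))"

definition broken_line :: "real \<Rightarrow> (nat \<Rightarrow> real) \<Rightarrow> (nat \<Rightarrow> real) \<Rightarrow> real \<Rightarrow> real" where
  "broken_line a m s x = (\<Sum>n. s n * ramp (a + sum m {..<n}) (m n) x)"

lemma ramp_mono: "x \<le> y \<Longrightarrow> ramp u m x \<le> ramp u m y"
  by (auto simp: ramp_def)

lemma ramp_nonneg: "0 \<le> ramp u m x"
  by (simp add: ramp_def)

lemma ramp_le: "0 \<le> m \<Longrightarrow> ramp u m x \<le> m"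
  by (simp add: ramp_def)

text \<open>The first \<open>N\<close> intervals are laid end to end from \<open>a\<close>, so their
  parts to the left of \<open>x\<close> form one interval starting at \<open>a\<close>.\<close>

lemma sum_ramp:
  fixes m :: "nat \<Rightarrow> real"
  assumes "a \<le> x" "\<And>n. 0 \<le> m n"
  shows "(\<Sum>n<N. ramp (a + sum m {..<n}) (m n) x) = min (sum m {..<N}) (x - a)"
proof (induction N)
  case 0
  then show ?case using assms by simp
next
  case (Suc N)
  have "(\<Sum>n<Suc N. ramp (a + sum m {..<n}) (m n) x)
      = min (sum m {..<N}) (x - a) + ramp (a + sum m {..<N}) (m N) x"
    using Suc.IH by simp
  also have "\<dots> = min (sum m {..<Suc N}) (x - a)"
    using assms(2)[of N] by (simp add: ramp_def min_def max_def)
  finally show ?case .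
qed

lemma summable_broken_line:
  assumes "\<And>n. 0 \<le> m n" "\<And>n. 0 \<le> s n" "summable (\<lambda>n. s n * m n)"
  shows "summable (\<lambda>n. s n * ramp (u n) (m n) x)"
  using assms(3)
  by (rule summable_comparison_test') (use assms in \<open>auto simp: abs_mult ramp_nonneg intro!: mult_left_mono ramp_le\<close>)

lemma broken_line_diff:
  assumes "\<And>n. 0 \<le> m n" "\<And>n. 0 \<le> s n" "summable (\<lambda>n. s n * m n)"
  shows "(\<lambda>n. s n * (ramp (a + sum m {..<n}) (m n) y - ramp (a + sum m {..<n}) (m n) x))
    sums (broken_line a m s y - broken_line a m s x)"
  unfolding broken_line_def right_diff_distrib
  by (intro sums_diff summable_sums summable_broken_line assms)

text \<open>On each partition interval the difference quotient is an average of the slopes, so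
  Jensen applies. Summing over the partition, the overlaps with the \<open>n\<close>-th slope
  interval add up to at most \<open>m n\<close>.\<close>

lemma riesz_variation_broken_line_le:
  assumes "\<phi> \<in> Phi_c" "a \<le> b"
    and m: "\<And>n. 0 \<le> m n" and s: "\<And>n. 0 \<le> s n" and sm: "summable (\<lambda>n. s n * m n)"
  shows "riesz_variation \<phi> {a..b} (broken_line a m s) \<le> (\<Sum>n. ennreal (m n) * \<phi> (s n))"
  unfolding riesz_variation_def
proof (rule SUP_least)
  fix D assume D: "D \<in> partitions {a..b}"
  define L where "L n = ramp (a + sum m {..<n}) (m n)" for n
  define f where "f = broken_line a m s"
  have "(\<Sum>K\<in>D. \<phi> (\<bar>f (Inf K) - f (Sup K)\<bar> / measure lborel K) * ennreal (measure lborel K))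
     \<le> (\<Sum>K\<in>D. \<Sum>n. ennreal (L n (Sup K) - L n (Inf K)) * \<phi> (s n))"
  proof (rule sum_mono)
    fix K assume "K \<in> D"
    then obtain x y where K: "K = {x..y}" "x < y" "a \<le> x" "y \<le> b"
      using D by (elim partitions_interval)
    \<comment> \<open>The fraction of \<open>{x..y}\<close> covered by the \<open>n\<close>-th slope
      interval. These fractions may sum to less than 1 when part of \<open>{x..y}\<close> lies
      beyond all slope intervals.\<close>
    define \<theta> where "\<theta> n = (L n y - L n x) / (y - x)" for n
    have \<theta>: "0 \<le> \<theta> n" for n
      using K ramp_mono[of x y] by (simp add: \<theta>_def L_def)
    have "(\<lambda>n. s n * (L n y - L n x)) sums (f y - f x)"
      unfolding L_def f_def by (rule broken_line_diff[OF m s sm])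
    then have sums: "(\<lambda>n. \<theta> n * s n) sums ((f y - f x) / (y - x))"
      unfolding \<theta>_def by (auto dest: sums_divide[of _ _ "y - x"] simp: mult.commute)
    have "sum \<theta> {..<N} = (min (sum m {..<N}) (y - a) - min (sum m {..<N}) (x - a)) / (y - x)" for N
      using K m by (simp add: \<theta>_def L_def sum_divide_distrib[symmetric] sum_subtractf sum_ramp)
    \<comment> \<open>Truncating at a constant does not increase distances.\<close>
    then have le1: "sum \<theta> {..<N} \<le> 1" for N
      using K by (auto simp: min_def)
    have pos: "0 \<le> (f y - f x) / (y - x)"
      using sums \<theta> s by (auto intro!: sums_le[OF _ sums_zero sums])
    then have "f x \<le> f y"
      using K by (simp add: zero_le_divide_iff)
    then have "\<phi> (\<bar>f x - f y\<bar> / (y - x)) = \<phi> (\<Sum>n. \<theta> n * s n)"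
      using sums_unique[OF sums] by simp
    also have "\<dots> \<le> (\<Sum>n. ennreal (\<theta> n) * \<phi> (s n))"
      using sums by (intro Phi_c_jensen_suminf assms \<theta> s le1) (auto simp: sums_iff)
    finally have "\<phi> (\<bar>f x - f y\<bar> / (y - x)) * ennreal (y - x)
        \<le> (\<Sum>n. ennreal (\<theta> n) * \<phi> (s n)) * ennreal (y - x)"
      by (rule mult_right_mono) simp
    also have "\<dots> = (\<Sum>n. ennreal (y - x) * (ennreal (\<theta> n) * \<phi> (s n)))"
      by (simp add: mult.commute)
    also have "\<dots> = (\<Sum>n. ennreal (L n y - L n x) * \<phi> (s n))"
    proof (intro suminf_cong)
      fix n
      have "ennreal (y - x) * ennreal (\<theta> n) = ennreal (L n y - L n x)"
        using K \<theta>[of n] by (subst ennreal_mult[symmetric]) (auto simp: \<theta>_def)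
      then show "ennreal (y - x) * (ennreal (\<theta> n) * \<phi> (s n)) = ennreal (L n y - L n x) * \<phi> (s n)"
        by (simp add: mult.assoc[symmetric])
    qed
    finally show "\<phi> (\<bar>f (Inf K) - f (Sup K)\<bar> / measure lborel K) * ennreal (measure lborel K)
        \<le> (\<Sum>n. ennreal (L n (Sup K) - L n (Inf K)) * \<phi> (s n))"
      using K by simp
  qed
  also have "\<dots> = (\<Sum>n. \<Sum>K\<in>D. ennreal (L n (Sup K) - L n (Inf K)) * \<phi> (s n))"
    by (rule suminf_sum[symmetric]) simp
  also have "\<dots> \<le> (\<Sum>n. ennreal (m n) * \<phi> (s n))"
  proof (intro suminf_le)
    fix n
    have "0 \<le> L n (Sup K) - L n (Inf K)" if "K \<in> D" for K
      using D that unfolding L_def by (elim partitions_interval) (auto intro: ramp_mono)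
    then have "(\<Sum>K\<in>D. ennreal (L n (Sup K) - L n (Inf K))) = ennreal (L n b - L n a)"
      using partitions_sum_increments[OF D assms(2), of "L n"] by simp
    also have "\<dots> \<le> ennreal (m n)"
      using ramp_le[OF m] ramp_nonneg unfolding L_def by (intro ennreal_leI) (simp add: add_increasing2 diff_le_eq)
    finally show "(\<Sum>K\<in>D. ennreal (L n (Sup K) - L n (Inf K)) * \<phi> (s n)) \<le> ennreal (m n) * \<phi> (s n)"
      unfolding sum_distrib_right[symmetric] by (rule mult_right_mono) simp
  qed auto
  finally show "(\<Sum>K\<in>D. \<phi> (\<bar>broken_line a m s (Inf K) - broken_line a m s (Sup K)\<bar> / measure lborel K) * ennreal (measure lborel K))
      \<le> (\<Sum>n. ennreal (m n) * \<phi> (s n))"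
    by (simp add: f_def)
qed

text \<open>The partition consists of the first \<open>N\<close> slope intervals and the remainder
  up to \<open>b\<close>, which \<open>lt\<close> makes non-degenerate; the remainder's nonnegative
  term is dropped.\<close>

lemma riesz_variation_broken_line_ge:
  assumes "\<psi> \<in> Phi_c" "0 \<le> l"
    and m: "\<And>n. 0 < m n" and s: "\<And>n. 0 \<le> s n" and sm: "summable (\<lambda>n. s n * m n)"
    and lt: "sum m {..<N} < b - a"
  shows "(\<Sum>n<N. ennreal (m n) * \<psi> (l * s n)) \<le> riesz_variation \<psi> {a..b} (\<lambda>x. l * broken_line a m s x)"
proof -
  define u where "u n = a + sum m {..<n}" for n
  define f where "f = broken_line a m s"
  define v where "v n = (if n \<le> N then u n else b)" for n
  have v: "v 0 = a" "v (Suc N) = b"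
    by (auto simp: v_def u_def)
  have incr: "v i < v (Suc i)" if "i \<le> N" for i
    using that m[of i] lt by (cases "i = N") (auto simp: v_def u_def)
  note part = partitions_of_increasing_sequence[of N v, OF incr, unfolded v]
  let ?g = "\<lambda>K. \<psi> (\<bar>l * f (Inf K) - l * f (Sup K)\<bar> / measure lborel K) * ennreal (measure lborel K)"
  have "(\<Sum>n<N. ennreal (m n) * \<psi> (l * s n)) \<le> (\<Sum>n<N. ?g {v n..v (Suc n)})"
  proof (rule sum_mono)
    fix n assume "n \<in> {..<N}"
    then have vn: "v n = u n" "v (Suc n) = u n + m n"
      by (auto simp: v_def u_def)
    let ?d = "\<lambda>k. s k * (ramp (u k) (m k) (u n + m n) - ramp (u k) (m k) (u n))"
    have sums: "?d sums (f (u n + m n) - f (u n))"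
      unfolding f_def u_def using m by (intro broken_line_diff sm s) (auto intro: less_imp_le)
    have nonneg: "0 \<le> ?d k" for k
      using s m[of n] ramp_mono[of "u n" "u n + m n"] by simp
    \<comment> \<open>The \<open>n\<close>-th ramp alone rises by \<open>m n\<close> here. All other
      ramps are non-decreasing, so this single term bounds the increment of \<open>f\<close> from
      below.\<close>
    have "s n * m n = ?d n"
      using m[of n] by (simp add: ramp_def)
    also have "\<dots> \<le> f (u n + m n) - f (u n)"
      using sums sum_le_suminf[of ?d "{n}"] nonneg by (auto simp: sums_iff)
    finally have "s n * m n \<le> \<bar>f (u n) - f (u n + m n)\<bar>" by simp
    then have "l * (s n * m n) \<le> l * \<bar>f (u n) - f (u n + m n)\<bar>"
      using assms(2) by (rule mult_left_mono)
    also have "\<dots> = \<bar>l * f (u n) - l * f (u n + m n)\<bar>"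
      using assms(2) by (simp add: right_diff_distrib[symmetric] abs_mult)
    finally have "l * s n \<le> \<bar>l * f (u n) - l * f (u n + m n)\<bar> / m n"
      using m[of n] by (simp add: pos_le_divide_eq mult.assoc)
    then have "\<psi> (l * s n) \<le> \<psi> (\<bar>l * f (u n) - l * f (u n + m n)\<bar> / m n)"
      using assms(2) s by (intro Phi_c_mono[OF assms(1)]) auto
    then have "ennreal (m n) * \<psi> (l * s n) \<le> ennreal (m n) * \<psi> (\<bar>l * f (u n) - l * f (u n + m n)\<bar> / m n)"
      by (rule mult_left_mono) simp
    then show "ennreal (m n) * \<psi> (l * s n) \<le> ?g {v n..v (Suc n)}"
      using m[of n] by (simp add: vn mult.commute)
  qed
  also have "\<dots> \<le> (\<Sum>n\<le>N. ?g {v n..v (Suc n)})"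
    by (intro sum_mono2) auto
  also have "\<dots> = sum ?g ((\<lambda>i. {v i..v (Suc i)}) ` {..N})"
    using part(2) by (simp add: sum.reindex)
  also have "\<dots> \<le> riesz_variation \<psi> {a..b} (\<lambda>x. l * f x)"
    unfolding riesz_variation_def by (intro SUP_upper part(1))
  finally show ?thesis by (simp add: f_def)
qed

section \<open>Comparison of the spaces\<close>

lemma RBV_subset_imp_dominated:
  assumes "\<phi> \<in> Phi_c" "\<psi> \<in> Phi_c" "a < b" and sub: "RBV \<phi> {a..b} \<subseteq> RBV \<psi> {a..b}"
  shows "\<exists>c>0. \<exists>k>0. \<forall>t\<ge>0. \<psi> t \<le> ennreal c * (\<phi> (k * t) + 1)"
proof (rule ccontr)
  assume "\<not> ?thesis"
  then have neg: "\<exists>t\<ge>0. ennreal c * (\<phi> (k * t) + 1) < \<psi> t" if "0 < c" "0 < k" for c k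
    using that by (meson not_le)
  \<comment> \<open>Chosen so that the total length of the slope intervals, at most
    \<open>1 / A\<close>, stays strictly below \<open>b - a\<close>.\<close>
  define A where "A = 1 / (b - a) + 1"
  have A: "0 < A" "1 / A < b - a"
  proof -
    have "A * (b - a) = 1 + (b - a)"
      using assms(3) by (simp add: A_def distrib_right)
    then have "1 < A * (b - a)"
      using assms(3) by simp
    moreover show "0 < A"
      using assms(3) by (simp add: A_def add_pos_pos)
    ultimately show "1 / A < b - a"
      by (simp add: divide_less_eq mult.commute)
  qed
  have "\<exists>t\<ge>0. ennreal (A * 2 ^ Suc n) * (\<phi> (real (Suc n) * t) + 1) < \<psi> t" for n
    using A by (intro neg) auto
  then obtain t where t: "\<And>n. 0 \<le> t n"
    and big: "\<And>n. ennreal (A * 2 ^ Suc n) * (\<phi> (real (Suc n) * t n) + 1) < \<psi> (t n)"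
    by metis
  define s where "s n = real (Suc n) * t n" for n
  have s: "0 \<le> s n" for n
    using t by (simp add: s_def)
  \<comment> \<open>An infinite \<open>\<phi> (s n)\<close> would make the left side of the strict
    inequality \<open>big\<close> infinite.\<close>
  have "\<phi> (s n) \<noteq> top" for n
    using big[of n] A by (auto simp: s_def ennreal_mult_top)
  then have "\<exists>r\<ge>0. \<phi> (s n) = ennreal r" for n
    by (metis ennreal_cases)
  then obtain r where r: "\<And>n. 0 \<le> r n" "\<And>n. \<phi> (s n) = ennreal (r n)"
    by metis
  \<comment> \<open>This makes \<open>m n * (r n + 1)\<close> geometric with sum
    \<open>1 / A\<close>, which bounds both the total length and the
    \<open>\<phi>\<close>-variation.\<close>
  define m where "m n = 1 / (A * 2 ^ Suc n * (r n + 1))" for n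
  have m: "0 < m n" for n
    using A r(1)[of n] by (simp add: m_def add_nonneg_pos)
  have mr: "m n * (r n + 1) = 1 / A * (1 / 2) ^ Suc n" for n
    using r(1)[of n] by (simp add: m_def power_one_over)
  have geo: "(\<lambda>n. 1 / A * (1 / 2) ^ Suc n) sums (1 / A)"
    using sums_mult[OF power_half_series, of "1 / A"] by simp
  have "m n \<le> m n * (r n + 1)" for n
    using m[of n] r(1)[of n] by (simp add: less_imp_le distrib_left)
  then have "sum m {..<N} \<le> (\<Sum>n<N. 1 / A * (1 / 2) ^ Suc n)" for N
    unfolding mr by (intro sum_mono)
  also have "(\<Sum>n<N. 1 / A * (1 / 2) ^ Suc n) \<le> 1 / A" for N
    using geo A sum_le_suminf[of "\<lambda>n. 1 / A * (1 / 2) ^ Suc n" "{..<N}"] by (auto simp: sums_iff)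
  finally have lt: "sum m {..<N} < b - a" for N
    using A(2) by (meson le_less_trans)
  obtain T where T: "0 < T" "\<And>x. 0 \<le> x \<Longrightarrow> ennreal x \<le> ennreal T * (\<phi> x + 1)"
    using Phi_c_superlinear[OF assms(1)] by blast
  \<comment> \<open>Compares the rises \<open>s n * m n\<close> with the same geometric series, so
    that the broken line is a convergent sum.\<close>
  have sT: "s n \<le> T * (r n + 1)" for n
  proof -
    have "ennreal (s n) \<le> ennreal T * (ennreal (r n) + 1)"
      using T(2)[OF s[of n]] by (simp add: r(2))
    also have "\<dots> = ennreal (T * (r n + 1))"
      using T(1) r(1)[of n] by (simp add: ennreal_mult)
    finally show ?thesis
      using T(1) r(1)[of n] by (subst (asm) ennreal_le_iff) auto
  qed
  have sm: "summable (\<lambda>n. s n * m n)"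
  proof (rule summable_comparison_test')
    show "summable (\<lambda>n. T * (1 / A * (1 / 2) ^ Suc n))"
      using geo by (intro summable_mult) (auto simp: sums_iff)
    fix n
    have "s n * m n \<le> T * (r n + 1) * m n"
      using m[of n] by (intro mult_right_mono sT) auto
    also have "\<dots> = T * (1 / A * (1 / 2) ^ Suc n)"
      unfolding mr[symmetric] by (simp only: ac_simps)
    finally show "norm (s n * m n) \<le> T * (1 / A * (1 / 2) ^ Suc n)"
      using s[of n] m[of n] by (simp add: abs_mult)
  qed
  \<comment> \<open>Members of \<open>RBV\<close> are extensional functions on the interval; the
    restriction leaves the variation unchanged.\<close>
  define F where "F = restrict (broken_line a m s) {a..b}"
  have F: "riesz_variation \<eta> {a..b} (\<lambda>x. l * F x) = riesz_variation \<eta> {a..b} (\<lambda>x. l * broken_line a m s x)" for l \<eta>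
    by (rule riesz_variation_cong) (simp add: F_def)
  have "riesz_variation \<phi> {a..b} (broken_line a m s) \<le> (\<Sum>n. ennreal (m n) * \<phi> (s n))"
    using m s assms sm by (intro riesz_variation_broken_line_le) (auto intro: less_imp_le)
  also have "\<dots> = (\<Sum>n. ennreal (m n * r n))"
  proof (rule suminf_cong)
    show "ennreal (m n) * \<phi> (s n) = ennreal (m n * r n)" for n
      using m[of n] r(1)[of n] by (simp add: r(2) ennreal_mult)
  qed
  also have "\<dots> < \<infinity>"
  proof -
    have "summable (\<lambda>n. m n * r n)"
    proof (rule summable_comparison_test')
      show "summable (\<lambda>n. 1 / A * (1 / 2) ^ Suc n)"
        using geo by (simp add: sums_iff)
      show "norm (m n * r n) \<le> 1 / A * (1 / 2) ^ Suc n" for n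
      proof -
        have "0 \<le> m n * r n" "m n * r n \<le> m n * (r n + 1)"
          using m[of n] r(1)[of n] by (auto intro: mult_left_mono)
        then show ?thesis by (simp only: mr real_norm_def abs_of_nonneg)
      qed
    qed
    moreover have "0 \<le> m n * r n" for n
      using m[of n] r(1)[of n] by simp
    ultimately have "(\<Sum>n. ennreal (m n * r n)) \<noteq> top"
      by (rule ennreal_suminf_neq_top)
    then show ?thesis
      by (simp only: infinity_ennreal_def less_top)
  qed
  finally have "F \<in> RBV \<phi> {a..b}"
    using F[of \<phi> 1] by (auto simp: RBV_iff[OF assms(1)] F_def intro!: exI[of _ 1])
  then obtain l where l: "0 < l" "riesz_variation \<psi> {a..b} (\<lambda>x. l * F x) < \<infinity>"
    using sub RBV_iff[OF assms(2)] by blast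
  \<comment> \<open>From index \<open>j\<close> on, the factor \<open>n + 1\<close> in
    \<open>s n\<close> outweighs \<open>l\<close>, so \<open>l * s n \<ge> t n\<close>.\<close>
  obtain j where j: "1 / l \<le> real j"
    using real_arch_simple by blast
  have ge1: "1 \<le> ennreal (m n) * \<psi> (l * s n)" if "j \<le> n" for n
  proof -
    have "1 \<le> l * real j"
      using j l(1) by (simp add: divide_le_eq mult.commute)
    also have "\<dots> \<le> l * real (Suc n)"
      using that l(1) by (intro mult_left_mono) auto
    finally have "1 \<le> l * real (Suc n)" .
    then have "t n \<le> l * s n"
      using t[of n] mult_right_mono[of 1 "l * real (Suc n)" "t n"] by (simp add: s_def mult.assoc)
    then have "\<psi> (t n) \<le> \<psi> (l * s n)"
      using t by (intro Phi_c_mono[OF assms(2)])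
    then have "ennreal (A * 2 ^ Suc n) * (\<phi> (s n) + 1) \<le> \<psi> (l * s n)"
      using big[of n] by (simp add: s_def)
    then have "ennreal (A * 2 ^ Suc n * (r n + 1)) \<le> \<psi> (l * s n)"
      using A r(1)[of n] by (simp add: r(2) ennreal_mult)
    then have "ennreal (m n) * ennreal (A * 2 ^ Suc n * (r n + 1)) \<le> ennreal (m n) * \<psi> (l * s n)"
      by (rule mult_left_mono) simp
    moreover have "ennreal (m n) * ennreal (A * 2 ^ Suc n * (r n + 1)) = ennreal (m n * (A * 2 ^ Suc n * (r n + 1)))"
      using m[of n] A r(1)[of n] by (intro ennreal_mult[symmetric]) auto
    moreover have "m n * (A * 2 ^ Suc n * (r n + 1)) = 1"
      using m[of n] by (auto simp: m_def)
    ultimately show ?thesis by simp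
  qed
  \<comment> \<open>The \<open>M\<close> terms from index \<open>j\<close> on contribute at least 1
    each, and \<open>M\<close> is arbitrary.\<close>
  have "of_nat M \<le> riesz_variation \<psi> {a..b} (\<lambda>x. l * F x)" for M
  proof -
    have "of_nat M = (\<Sum>n\<in>{j..<j + M}. 1 :: ennreal)"
      by simp
    also have "\<dots> \<le> (\<Sum>n\<in>{j..<j + M}. ennreal (m n) * \<psi> (l * s n))"
      by (intro sum_mono ge1) auto
    also have "\<dots> \<le> (\<Sum>n<j + M. ennreal (m n) * \<psi> (l * s n))"
      by (intro sum_mono2) auto
    also have "\<dots> \<le> riesz_variation \<psi> {a..b} (\<lambda>x. l * F x)"
      unfolding F using assms l m s sm lt by (intro riesz_variation_broken_line_ge) auto
    finally show ?thesis .
  qed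
  moreover obtain M where "riesz_variation \<psi> {a..b} (\<lambda>x. l * F x) < of_nat M"
    using l(2) ennreal_Ex_less_of_nat by auto
  ultimately show False
    by (meson not_le)
qed

theorem mainTheorem4:
  fixes a b p :: real and \<phi> :: "real \<Rightarrow> ennreal"
  assumes "a < b" and "p > 1" and "\<phi> \<in> Phi_c"
  shows "RBV \<phi> {a..b} = RBV (power_phi p) {a..b} \<longleftrightarrow>
    (\<exists>c\<ge>1. \<forall>t\<ge>0. ereal (1 / c * t powr p - c) \<le> enn2ereal (\<phi> t) \<and>
                  enn2ereal (\<phi> t) \<le> ereal (c * t powr p + c))"
proof -
  have pow: "power_phi p \<in> Phi_c"
    using assms(2) by (intro power_phi_in_Phi_c) simp
  show ?thesis
  proof
    assume eq: "RBV \<phi> {a..b} = RBV (power_phi p) {a..b}"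
    obtain c k where ck: "0 < c" "0 < k"
      and lower: "\<And>t. 0 \<le> t \<Longrightarrow> power_phi p t \<le> ennreal c * (\<phi> (k * t) + 1)"
      using RBV_subset_imp_dominated[OF assms(3) pow assms(1)] eq by auto
    obtain d j where dj: "0 < d" "0 < j"
      and upper: "\<And>t. 0 \<le> t \<Longrightarrow> \<phi> t \<le> ennreal d * (power_phi p (j * t) + 1)"
      using RBV_subset_imp_dominated[OF pow assms(3) assms(1)] eq by auto
    \<comment> \<open>Homogeneity of the power moves the inner factors \<open>k\<close> and
      \<open>j\<close> outside as \<open>k powr p\<close> and \<open>j powr p\<close>;
      \<open>C\<close> dominates every resulting constant.\<close>
    define C where "C = 1 + k powr p * c + d * j powr p + d"
    have C: "1 \<le> C" "k powr p * c \<le> C" "d * j powr p \<le> C" "d \<le> C"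
      using ck dj by (auto simp: C_def)
    have "ereal (1 / C * t powr p - C) \<le> enn2ereal (\<phi> t) \<and> enn2ereal (\<phi> t) \<le> ereal (C * t powr p + C)"
      if t: "0 \<le> t" for t
    proof -
      have "\<phi> t \<le> ennreal (d * ((j * t) powr p + 1))"
        using upper[OF t] dj by (simp add: power_phi_def ennreal_mult)
      then obtain r where r: "\<phi> t = ennreal r" "0 \<le> r" "r \<le> d * ((j * t) powr p + 1)"
        using dj by (cases "\<phi> t") (auto simp: top_unique)
      have "r \<le> d * j powr p * t powr p + d"
        using r(3) dj t by (simp add: powr_mult algebra_simps)
      also have "\<dots> \<le> C * t powr p + C"
        using C by (intro add_mono mult_right_mono) auto
      finally have upper_r: "r \<le> C * t powr p + C" .
      \<comment> \<open>Taking the lower estimate at \<open>t / k\<close> turns the argument of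
        \<open>\<phi>\<close> into \<open>t\<close>.\<close>
      have "ennreal ((t / k) powr p) \<le> ennreal (c * (r + 1))"
        using lower[of "t / k"] t ck r by (simp add: power_phi_def ennreal_mult)
      then have "(t / k) powr p \<le> c * (r + 1)"
        using r ck by (subst (asm) ennreal_le_iff) auto
      then have "t powr p \<le> k powr p * c * (r + 1)"
        using ck t by (simp add: powr_divide field_simps)
      also have "\<dots> \<le> C * (r + 1)"
        using C r by (intro mult_right_mono) auto
      also have "\<dots> \<le> C * (r + C)"
        using C by (intro mult_left_mono) auto
      finally have "t powr p / C \<le> r + C"
        using C(1) by (simp add: divide_le_eq mult.commute)
      then have "1 / C * t powr p - C \<le> r"
        by simp
      with upper_r show ?thesis
        using r by (simp add: enn2ereal_ennreal)
    qed
    then show "\<exists>c\<ge>1. \<forall>t\<ge>0. ereal (1 / c * t powr p - c) \<le> enn2ereal (\<phi> t) \<and>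
                  enn2ereal (\<phi> t) \<le> ereal (c * t powr p + c)"
      using C(1) by blast
  next
    assume "\<exists>c\<ge>1. \<forall>t\<ge>0. ereal (1 / c * t powr p - c) \<le> enn2ereal (\<phi> t) \<and>
                  enn2ereal (\<phi> t) \<le> ereal (c * t powr p + c)"
    then obtain c where c: "1 \<le> c"
      and bounds: "\<And>t. 0 \<le> t \<Longrightarrow> ereal (1 / c * t powr p - c) \<le> enn2ereal (\<phi> t)"
        "\<And>t. 0 \<le> t \<Longrightarrow> enn2ereal (\<phi> t) \<le> ereal (c * t powr p + c)"
      by blast
    \<comment> \<open>The constant \<open>c * c\<close> arises from
      \<open>t powr p \<le> c * (r + c)\<close> and \<open>c \<ge> 1\<close>. The form
      \<open>1 * t\<close> matches \<open>RBV_mono_dominated\<close> with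
      \<open>k = 1\<close>.\<close>
    have dom: "power_phi p t \<le> ennreal (c * c) * (\<phi> (1 * t) + 1) \<and> \<phi> t \<le> ennreal c * (power_phi p (1 * t) + 1)"
      if t: "0 \<le> t" for t
    proof -
      obtain r where r: "\<phi> t = ennreal r" "0 \<le> r"
        using bounds(2)[OF t] by (cases "\<phi> t") auto
      have "r \<le> c * (t powr p + 1)"
        using bounds(2)[OF t] r by (simp add: enn2ereal_ennreal algebra_simps)
      moreover have "t powr p \<le> c * (r + c)"
        using bounds(1)[OF t] r c by (simp add: enn2ereal_ennreal field_simps)
      moreover have "c * (r + c) \<le> c * (c * (r + 1))"
        using r c mult_right_mono[of 1 c r] by (intro mult_left_mono) (auto simp: algebra_simps)
      ultimately have "ennreal r \<le> ennreal (c * (t powr p + 1))"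
        "ennreal (t powr p) \<le> ennreal (c * c * (r + 1))"
        by (auto intro!: ennreal_leI simp: mult.assoc)
      then show ?thesis
        using r c by (simp add: power_phi_def ennreal_mult)
    qed
    show "RBV \<phi> {a..b} = RBV (power_phi p) {a..b}"
    proof (rule equalityI)
      show "RBV \<phi> {a..b} \<subseteq> RBV (power_phi p) {a..b}"
        using dom assms pow by (intro RBV_mono_dominated[where c = "c * c" and k = 1]) auto
      show "RBV (power_phi p) {a..b} \<subseteq> RBV \<phi> {a..b}"
        using dom assms pow by (intro RBV_mono_dominated[where c = c and k = 1]) auto
    qed
  qed
qed

end
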